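(* Let $p,q$ be integers with $p>q\ge 2$. Then the graph $G_{p,q}$ is a connected balanced bipartite Parter graph without a perfect matching, and it has cycle rank $$m(G_{p,q})=(q-1)(2p-1).$$ In particular, for every odd integer $r\ge 5$, there exists a connected balanced bipartite Parter graph $G$ with $m(G)=r$ that does not have a perfect matching.
   Context: All graphs are finite and simple, and all matrices are real and symmetric unless rectangular. For a graph $G$ with vertex set $\{1,\dots,n\}$, let $S(G)$ be the set of real symmetric $n\times n$ matrices $A=(a_{ij})$ such that for all $i\neq j$, $a_{ij}\neq 0$ if and only if $ij$ is an edge of $G$ (diagonal entries are arbitrary). For a vertex $v$, $A(v)$ denotes the principal submatrix of $A$ obtained by deleting the row and column indexed by $v$. A graph $G$ is called a Parter graph if there exists a nonsingular matrix $A\in S(G)$ such that $\det A(v)=0$ for every vertex $v$ of $G$ (equivalently, all diagonal entries of $A^{-1}$ are zero). The cycle rank of $G$ is $m(G)=|E(G)|-|V(G)|+k(G)$, where $k(G)$ is the number of connected components of $G$. A bipartite graph is balanced if its two partite sets have equal size. For integers $p>q\ge 2$, the bipartite graph $G_{p,q}$ has partite sets $U=U_1\cup U_2$ and $V=V_1\cup V_2$ (disjoint unions), where $|U_1|=|V_2|=p$, $|U_2|=|V_1|=q$, $U_2=\{x_1,\dots,x_q\}$, $V_1=\{v_1,\dots,v_q\}$, and edge set $$E(G_{p,q})=\{uv: u\in U_1, v\in V_1\}\cup\{xw: x\in U_2, w\in V_2\}\cup\{x_iv_i: 1\le i\le q\}.$$ *)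

theory Defs
  imports "Jordan_Normal_Form.Determinant" "Graph_Theory.Digraph_Component"
    "Graph_Theory.Pair_Digraph"
begin

(* A finite simple graph is a pair_graph (finite, loopfree, symmetric arc relation).  Each
   undirected edge is represented by two opposite arcs, so edges are taken as unordered pairs. *)

definition edges :: "'a pair_pre_digraph \<Rightarrow> 'a set set" where
  "edges G = {{u, v} | u v. (u, v) \<in> parcs G}"

(* For a symmetric arc relation the strongly connected components are the ordinary
   connected components. *)
definition num_components :: "'a pair_pre_digraph \<Rightarrow> nat" where
  "num_components G = card (pre_digraph.sccs_verts (with_proj G))"

definition cycle_rank :: "'a pair_pre_digraph \<Rightarrow> int" where
  "cycle_rank G = int (card (edges G)) - int (card (pverts G)) + int (num_components G)"

definition bipartition :: "'a pair_pre_digraph \<Rightarrow> 'a set \<Rightarrow> 'a set \<Rightarrow> bool" where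
  "bipartition G U V \<longleftrightarrow> pverts G = U \<union> V \<and> U \<inter> V = {} \<and> parcs G \<subseteq> U \<times> V \<union> V \<times> U"

definition balanced_bipartite :: "'a pair_pre_digraph \<Rightarrow> bool" where
  "balanced_bipartite G \<longleftrightarrow> (\<exists>U V. bipartition G U V \<and> card U = card V)"

definition perfect_matching :: "'a pair_pre_digraph \<Rightarrow> 'a set set \<Rightarrow> bool" where
  "perfect_matching G M \<longleftrightarrow> M \<subseteq> edges G \<and> (\<forall>v\<in>pverts G. \<exists>!e. e \<in> M \<and> v \<in> e)"

(* S(G), where row and column i of the matrix belong to the vertex vs ! i; vs is meant to be a
   repetition-free enumeration of the vertices. *)
definition sym_mats :: "'a list \<Rightarrow> 'a pair_pre_digraph \<Rightarrow> real mat set" where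
  "sym_mats vs G = {A \<in> carrier_mat (length vs) (length vs).
     transpose_mat A = A \<and>
     (\<forall>i<length vs. \<forall>j<length vs. i \<noteq> j \<longrightarrow> (A $$ (i, j) \<noteq> 0 \<longleftrightarrow> {vs ! i, vs ! j} \<in> edges G))}"

(* Reordering vs conjugates A by a permutation matrix, so the choice of vs is immaterial. *)
definition parter_graph :: "'a pair_pre_digraph \<Rightarrow> bool" where
  "parter_graph G \<longleftrightarrow> (\<exists>vs. distinct vs \<and> set vs = pverts G \<and>
     (\<exists>A \<in> sym_mats vs G. invertible_mat A \<and>
        (\<forall>i<length vs. det (mat_delete A i i) = 0)))"

(* The vertices are labelled 1, ..., 2p + 2q in the order U1, U2, V1, V2. *)
definition G_pq :: "nat \<Rightarrow> nat \<Rightarrow> nat pair_pre_digraph" where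
  "G_pq p q =
    (let x = (\<lambda>i. p + i);
         v = (\<lambda>i. p + q + i);
         U1 = {1..p};
         U2 = x ` {1..q};
         V1 = v ` {1..q};
         V2 = {p + 2 * q + 1..2 * p + 2 * q};
         E = U1 \<times> V1 \<union> U2 \<times> V2 \<union> {(x i, v i) | i. i \<in> {1..q}}
     in \<lparr> pverts = U1 \<union> U2 \<union> V1 \<union> V2, parcs = E \<union> E\<inverse> \<rparr>)"

end

(* A perfect matching would inject U1 into its neighbourhood V1, which is too small since p > q.
   For the Parter property one needs a matrix in S(G) whose inverse has zero diagonal.  With the
   vertices ordered as U1, V1 | V2, U2, take A = [X Y; Y tX], where X = [-dI J; J eI] lives on the
   complete bipartite graph K_{p,q} and Y = [0 0; 0 I] is the matching between V1 and U2.  All blocks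
   lie in the span of I and J (the all-ones matrix), so A can be inverted explicitly with blocks of
   the same kind; requiring its diagonal blocks to be multiples of J - I leaves a small
   system of equations for t, d, e, which has a rational solution with t, d > 0 because p > q. *)

theory Submission
  imports Defs
begin

section \<open>Principal minors and the diagonal of the inverse\<close>

text \<open>The adjugate is \<open>det A\<close> times the inverse \<open>B\<close>, and its
  diagonal entries are the minors \<open>det (mat_delete A i i)\<close>; a zero diagonal of
  \<open>B\<close> therefore makes them vanish.\<close>

lemma parter_graphI:
  assumes "distinct vs" "set vs = pverts G" and A: "A \<in> sym_mats vs G"
    and B: "B \<in> carrier_mat (length vs) (length vs)" and AB: "A * B = 1\<^sub>m (length vs)"
    and diag: "\<And>i. i < length vs \<Longrightarrow> B $$ (i, i) = 0"
  shows "parter_graph G"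
proof -
  let ?n = "length vs"
  have A': "A \<in> carrier_mat ?n ?n"
    using A by (simp add: sym_mats_def)
  have BA: "B * A = 1\<^sub>m ?n"
    using mat_mult_left_right_inverse[OF A' B AB] .
  have inv: "invertible_mat A"
    unfolding invertible_mat_def inverts_mat_def
    using A' B AB BA by (auto intro!: exI[of _ B])
  have adj: "adj_mat A = det A \<cdot>\<^sub>m B"
  proof -
    have "adj_mat A = (B * A) * adj_mat A"
      using adj_mat(1)[OF A'] BA by simp
    also have "\<dots> = B * (det A \<cdot>\<^sub>m 1\<^sub>m ?n)"
      using assoc_mult_mat[OF B A' adj_mat(1)[OF A']] adj_mat(2)[OF A'] by simp
    also have "\<dots> = det A \<cdot>\<^sub>m B"
      using B by (simp add: mult_smult_distrib[OF B one_carrier_mat])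
    finally show ?thesis .
  qed
  have "det (mat_delete A i i) = 0" if "i < ?n" for i
  proof -
    have "cofactor A i i = adj_mat A $$ (i, i)"
      using that A' by (simp add: adj_mat_def)
    also have "\<dots> = 0"
      using that B diag adj by simp
    finally show ?thesis
      by (simp add: cofactor_def)
  qed
  with assms inv show ?thesis
    unfolding parter_graph_def by blast
qed

section \<open>Algebra of matrices with blocks spanned by I and J\<close>

text \<open>The matrix with blocks $aI + bJ$, $cJ$, $c'J$, $a'I + b'J$ (read by rows).\<close>

definition blk :: "nat \<Rightarrow> nat \<Rightarrow> real \<Rightarrow> real \<Rightarrow> real \<Rightarrow> real \<Rightarrow> real \<Rightarrow> real \<Rightarrow> real mat" where
  "blk p q a b c c' a' b' = mat (p + q) (p + q) (\<lambda>(i, j).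
     if i < p then if j < p then (if i = j then a else 0) + b else c
     else if j < p then c' else (if i = j then a' else 0) + b')"

lemma dim_blk [simp]:
  "dim_row (blk p q a b c c' a' b') = p + q" "dim_col (blk p q a b c c' a' b') = p + q"
  "blk p q a b c c' a' b' \<in> carrier_mat (p + q) (p + q)"
  by (simp_all add: blk_def)

lemma blk_index:
  "i < p + q \<Longrightarrow> j < p + q \<Longrightarrow> blk p q a b c c' a' b' $$ (i, j) =
     (if i < p then if j < p then (if i = j then a else 0) + b else c
     else if j < p then c' else (if i = j then a' else 0) + b')"
  by (simp add: blk_def)

lemma blk_one: "1\<^sub>m (p + q) = blk p q 1 0 0 0 1 0"
  by (rule eq_matI) (auto simp: blk_index)

lemma blk_zero: "0\<^sub>m (p + q) (p + q) = blk p q 0 0 0 0 0 0"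
  by (rule eq_matI) (auto simp: blk_index)

lemma blk_add:
  "blk p q a b c c' a' b' + blk p q u v w w' u' v' =
   blk p q (a + u) (b + v) (c + w) (c' + w') (a' + u') (b' + v')"
  by (rule eq_matI) (auto simp: blk_index)

text \<open>A product of two all-ones blocks is an all-ones block times the shared dimension, so
  matrices of this shape are closed under multiplication; the factors \<open>p\<close> and
  \<open>q\<close> are these dimensions.\<close>

lemma blk_mult:
  "blk p q a b c c' a' b' * blk p q u v w w' u' v' =
   blk p q (a * u) (a * v + b * u + p * b * v + q * c * w')
     (a * w + p * b * w + c * u' + q * c * v')
     (c' * u + p * c' * v + a' * w' + q * b' * w')
     (a' * u') (a' * v' + b' * u' + q * b' * v' + p * c' * w)"
    (is "?M * ?N = ?R")
proof (rule eq_matI)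
  fix i j assume "i < dim_row ?R" "j < dim_col ?R"
  then have ij: "i < p + q" "j < p + q" by simp_all
  have split: "(\<Sum>k<p + q. g k) = (\<Sum>k<p. g k) + (\<Sum>k\<in>{p..<p + q}. g k)" for g :: "nat \<Rightarrow> real"
    by (subst sum.union_disjoint[symmetric]) (auto intro: sum.cong)
  have "(?M * ?N) $$ (i, j) = (\<Sum>k<p + q. ?M $$ (i, k) * ?N $$ (k, j))"
    using ij by (simp add: scalar_prod_def atLeast0LessThan)
  also have "\<dots> =
      (\<Sum>k<p. (if i < p then (if k = i then a else 0) + b else c') *
                (if j < p then (if k = j then u else 0) + v else w)) +
      (\<Sum>k\<in>{p..<p + q}. (if i < p then c else (if k = i then a' else 0) + b') *
                (if j < p then w' else (if k = j then u' else 0) + v'))"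
    unfolding split using ij
    by (intro arg_cong2[where f = "(+)"] sum.cong) (auto simp: blk_index)
  also have "\<dots> = ?R $$ (i, j)"
    using ij
    by (auto simp: blk_index algebra_simps sum.distrib if_distrib[of "\<lambda>x. x * _"] if_distrib[of "\<lambda>x. _ * x"]
        cong: if_cong)
  finally show "(?M * ?N) $$ (i, j) = ?R $$ (i, j)" .
qed simp_all

lemma transpose_blk: "transpose_mat (blk p q a b c c' a' b') = blk p q a b c' c a' b'"
  by (rule eq_matI) (auto simp: blk_index)

lemma blk_cong:
  assumes "a = u" "b = v" "c = w" "c' = w'" "a' = u'" "b' = v'"
  shows "blk p q a b c c' a' b' = blk p q u v w w' u' v'"
  using assms by simp

lemma mult_sym_block:
  assumes "X \<in> carrier_mat n n" "X' \<in> carrier_mat n n" "Y \<in> carrier_mat n n"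
    "W \<in> carrier_mat n n" "W' \<in> carrier_mat n n" "Z \<in> carrier_mat n n"
    and "X * W + Y * Z = 1\<^sub>m n" "X * Z + Y * W' = 0\<^sub>m n n"
    "Y * W + X' * Z = 0\<^sub>m n n" "Y * Z + X' * W' = 1\<^sub>m n"
  shows "four_block_mat X Y Y X' * four_block_mat W Z Z W' = 1\<^sub>m (n + n)"
  using assms by (subst mult_four_block_mat[of _ n n _ n _ n]) auto

section \<open>The constants of the matrix and of its inverse\<close>

text \<open>The free scale is fixed by letting the Schur complement \<open>eI + (P / d) J\<close> of the block \<open>-dI\<close> in \<open>X\<close> have
  eigenvalue 1 on the constant vector.  Then \<open>\<kappa> = 1 / (1 - t)\<close> and \<open>k = 1 / (1 - t e\<^sup>2)\<close> are the eigenvalues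
  of the block of the inverse that joins \<open>V\<^sub>1\<close> and \<open>U\<^sub>2\<close>.\<close>

lemma parter_coefficients:
  fixes P Q :: real
  assumes "P > Q" "Q \<ge> 2"
  obtains t d \<beta> e \<kappa> k l where "t > 0" "d > 0"
    "\<beta> * (Q - 1) = d / Q" "k - e * \<beta> = 1" "P / Q + e * \<beta> + l = 0" "e * k * t = \<beta>"
    "P * \<kappa> * t / d + e * l * t + \<beta> = 0" "P * \<kappa> * Q / d\<^sup>2 + e * \<kappa> / d + 1 / (t * Q) = 0"
    "(P - 1) / d + e / Q + \<kappa> / d = 0" "k + l * Q = \<kappa>"
proof
  have ne: "P \<noteq> 0" "Q \<noteq> 0" "P - 1 \<noteq> 0" "P - Q \<noteq> 0" "P + 1 - Q \<noteq> 0" "2 * P - Q \<noteq> 0" "Q - 1 \<noteq> 0"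
    using assms by linarith+
  \<comment> \<open>With \<open>e = 1 - P * Q / d\<close>, a zero diagonal of the inverse amounts to
    \<open>t / (t - 1) = d / Q\<close> and \<open>(Q - 1) * e * k * t = d / Q\<close>. Eliminating
    \<open>d\<close> and dividing by \<open>t - 1\<close> leaves a linear equation, solved by
    \<open>t - 1 = (2 * P - Q) / ((P - 1) * (P - Q))\<close>. The first and the last required
    equation then give \<open>\<beta>\<close> and \<open>l\<close>.\<close>
  let ?t = "P * (P + 1 - Q) / ((P - 1) * (P - Q))"
    and ?d = "Q * P * (P + 1 - Q) / (2 * P - Q)"
    and ?\<beta> = "P * (P + 1 - Q) / ((Q - 1) * (2 * P - Q))"
    and ?e = "(1 - P) / (P + 1 - Q)"
    and ?\<kappa> = "- (P - 1) * (P - Q) / (2 * P - Q)"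
    and ?k = "- (P - Q) * (P + 1 - Q) / ((Q - 1) * (2 * P - Q))"
    and ?l = "P * (2 - Q) * (P - Q) / (Q * (Q - 1) * (2 * P - Q))"
  show "?t > 0" "?d > 0"
    using assms by simp_all
  show "?\<beta> * (Q - 1) = ?d / Q"
    using ne by simp
  show "?k - ?e * ?\<beta> = 1"
    using ne by (simp add: divide_simps) (simp add: algebra_simps)?
  show "P / Q + ?e * ?\<beta> + ?l = 0"
    using ne by (simp add: divide_simps) (simp add: algebra_simps)?
  show "?e * ?k * ?t = ?\<beta>"
    using ne by (simp add: divide_simps) (simp add: algebra_simps)?
  show "P * ?\<kappa> * ?t / ?d + ?e * ?l * ?t + ?\<beta> = 0"
    using ne by (simp add: divide_simps) (simp add: algebra_simps)?
  show "P * ?\<kappa> * Q / ?d\<^sup>2 + ?e * ?\<kappa> / ?d + 1 / (?t * Q) = 0"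
    using ne by (simp add: divide_simps power2_eq_square) (simp add: algebra_simps)?
  show "(P - 1) / ?d + ?e / Q + ?\<kappa> / ?d = 0"
    using ne by (simp add: divide_simps) (simp add: algebra_simps)?
  show "?k + ?l * Q = ?\<kappa>"
    using ne by (simp add: divide_simps) (simp add: algebra_simps)?
qed

section \<open>Arcs and edges of the graph\<close>

text \<open>Every edge occurs once, directed from \<open>U\<close> to \<open>V\<close>; the labels
  of \<open>x_i\<close> and \<open>v_i\<close> differ by \<open>q\<close>.\<close>

definition pq_arcs :: "nat \<Rightarrow> nat \<Rightarrow> nat rel" where
  "pq_arcs p q = {1..p} \<times> {p + q + 1..p + 2 * q} \<union>
     {p + 1..p + q} \<times> {p + 2 * q + 1..2 * p + 2 * q} \<union> (\<lambda>i. (i, i + q)) ` {p + 1..p + q}"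

lemma pq_arcs_iff:
  "(a, b) \<in> pq_arcs p q \<longleftrightarrow>
     1 \<le> a \<and> a \<le> p \<and> p + q < b \<and> b \<le> p + 2 * q \<or>
     p < a \<and> a \<le> p + q \<and> p + 2 * q < b \<and> b \<le> 2 * p + 2 * q \<or>
     p < a \<and> a \<le> p + q \<and> b = a + q"
  by (auto simp: pq_arcs_def)

lemma pverts_G_pq: "pverts (G_pq p q) = {1..2 * p + 2 * q}"
proof -
  have "(+) (p + q) ` {1..q} = {p + q + 1..p + 2 * q}" "(+) p ` {1..q} = {p + 1..p + q}"
    by (auto simp: image_add_atLeastAtMost)
  then show ?thesis
    by (auto simp: G_pq_def Let_def)
qed

lemma parcs_G_pq: "parcs (G_pq p q) = pq_arcs p q \<union> (pq_arcs p q)\<inverse>"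
proof -
  have 1: "(+) (p + q) ` {1..q} = {p + q + 1..p + 2 * q}" "(+) p ` {1..q} = {p + 1..p + q}"
    by (auto simp: image_add_atLeastAtMost)
  have 2: "{(p + i, p + q + i) | i. i \<in> {1..q}} = (\<lambda>i. (i, i + q)) ` {p + 1..p + q}"
    by (auto simp: image_iff) presburger
  show ?thesis
    unfolding G_pq_def Let_def pair_pre_digraph.simps 1 2 pq_arcs_def[symmetric] by simp
qed

lemma edges_G_pq: "edges (G_pq p q) = (\<lambda>(u, v). {u, v}) ` pq_arcs p q"
  unfolding edges_def parcs_G_pq by auto

lemma edge_G_pq_iff: "{a, b} \<in> edges (G_pq p q) \<longleftrightarrow> (a, b) \<in> pq_arcs p q \<or> (b, a) \<in> pq_arcs p q"
  unfolding edges_G_pq by (auto simp: doubleton_eq_iff)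

lemma pair_graph_G_pq: "pair_graph (G_pq p q)"
proof unfold_locales
  show "finite (parcs (G_pq p q))"
    by (simp add: parcs_G_pq pq_arcs_def)
  show "symmetric (with_proj (G_pq p q))"
    by (auto simp: symmetric_def parcs_G_pq sym_def)
qed (auto simp: pverts_G_pq parcs_G_pq pq_arcs_iff)

section \<open>Connectedness and cycle rank\<close>

text \<open>From vertex 1 in \<open>U1\<close> one reaches \<open>V1\<close>, then the rest of
  \<open>U1\<close> and, along the matching edges, \<open>U2\<close>, and finally \<open>V2\<close>;
  symmetry of the arcs gives all other pairs.\<close>

lemma reachable_G_pq:
  assumes "q \<ge> 1" "p \<ge> 1" "u \<in> pverts (G_pq p q)" "v \<in> pverts (G_pq p q)"
  shows "u \<rightarrow>\<^sup>*\<^bsub>with_proj (G_pq p q)\<^esub> v"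
proof -
  interpret pair_graph "G_pq p q" by (rule pair_graph_G_pq)
  let ?r = "\<lambda>v. 1 \<rightarrow>\<^sup>*\<^bsub>with_proj (G_pq p q)\<^esub> v"
  have step: "?r b" if "?r a" "(a, b) \<in> pq_arcs p q \<or> (b, a) \<in> pq_arcs p q" for a b
    using that(1) by (rule reachable_adj_trans) (use that(2) in \<open>auto simp: parcs_G_pq\<close>)
  have r1: "?r 1"
    using assms by (intro reachable_refl) (simp add: pverts_G_pq)
  have V1: "?r b" if "p + q < b" "b \<le> p + 2 * q" for b
    using r1 by (rule step) (use that assms in \<open>simp add: pq_arcs_iff\<close>)
  have U1: "?r b" if "1 \<le> b" "b \<le> p" for b
    using V1[of "p + q + 1"] by (rule step) (use that assms in \<open>auto simp add: pq_arcs_iff\<close>)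
  have U2: "?r b" if "p < b" "b \<le> p + q" for b
    using V1[of "b + q"] by (rule step) (use that assms in \<open>auto simp add: pq_arcs_iff\<close>)
  have V2: "?r b" if "p + 2 * q < b" "b \<le> 2 * p + 2 * q" for b
    using U2[of "p + 1"] by (rule step) (use that assms in \<open>auto simp add: pq_arcs_iff\<close>)
  have all: "?r b" if "b \<in> pverts (G_pq p q)" for b
    using that U1[of b] U2[of b] V1[of b] V2[of b] by (force simp: pverts_G_pq)
  have "u \<rightarrow>\<^sup>*\<^bsub>with_proj (G_pq p q)\<^esub> 1"
    using symmetric_reachable[OF pair_sym_arcs all[OF assms(3)]] .
  then show ?thesis
    using all[OF assms(4)] by (rule reachable_trans)
qed

lemma connected_G_pq:
  assumes "q \<ge> 1" "p \<ge> 1"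
  shows "Digraph_Component.connected (with_proj (G_pq p q))"
proof -
  interpret pair_graph "G_pq p q" by (rule pair_graph_G_pq)
  show ?thesis
    unfolding Digraph_Component.connected_def
    using assms reachable_G_pq[OF assms]
    by (intro strongly_connectedI reachable_mk_symmetricI)
       (auto simp: mk_symmetric_def pverts_G_pq)
qed

lemma num_components_strongly_connected:
  assumes "pair_wf_digraph G" "strongly_connected (with_proj G)"
  shows "num_components G = 1"
proof -
  interpret pair_wf_digraph G by fact
  have reach: "u \<rightarrow>\<^sup>*\<^bsub>with_proj G\<^esub> v" if "u \<in> pverts G" "v \<in> pverts G" for u v
    using assms(2) that by (simp add: strongly_connected_def)
  have ne: "pverts G \<noteq> {}"
    using assms(2) by (simp add: strongly_connected_def)
  have "S = pverts G" if S: "S \<in> sccs_verts" for S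
  proof -
    obtain u where "u \<in> S"
      using S by (auto simp: in_sccs_verts_conv_reachable)
    moreover have "S \<subseteq> pverts G"
      using S by (auto simp: in_sccs_verts_conv_reachable dest: reachable_in_verts)
    ultimately show ?thesis
      using S reach unfolding in_sccs_verts_conv_reachable by blast
  qed
  moreover have "pverts G \<in> sccs_verts"
    using ne reach by (auto simp: in_sccs_verts_conv_reachable dest: reachable_in_verts)
  ultimately have "sccs_verts = {pverts G}"
    by blast
  then show ?thesis
    by (simp add: num_components_def)
qed

lemma card_edges_G_pq: "card (edges (G_pq p q)) = 2 * p * q + q"
proof -
  \<comment> \<open>An arc goes from a label at most \<open>p + q\<close> to a larger one, so the
    unordered pair determines it.\<close>
  have "inj_on (\<lambda>(u, v). {u, v}) (pq_arcs p q)"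
    by (rule inj_onI) (auto simp: pq_arcs_iff doubleton_eq_iff)
  then have "card (edges (G_pq p q)) = card (pq_arcs p q)"
    unfolding edges_G_pq by (rule card_image)
  also have "\<dots> = p * q + q * p + q"
    unfolding pq_arcs_def
    by (subst card_Un_disjoint; (subst card_Un_disjoint)?)
       (auto simp: card_image inj_on_def card_cartesian_product)
  finally show ?thesis
    by simp
qed

lemma cycle_rank_G_pq:
  assumes "q \<ge> 1" "p \<ge> 1"
  shows "cycle_rank (G_pq p q) = (int q - 1) * (2 * int p - 1)"
proof -
  interpret pair_graph "G_pq p q" by (rule pair_graph_G_pq)
  have "num_components (G_pq p q) = 1"
    using assms reachable_G_pq[OF assms]
    by (intro num_components_strongly_connected pair_wf_digraph strongly_connectedI)
       (auto simp: pverts_G_pq)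
  then show ?thesis
    unfolding cycle_rank_def card_edges_G_pq pverts_G_pq by (simp add: algebra_simps)
qed

section \<open>Bipartition and perfect matchings\<close>

lemma balanced_bipartite_G_pq: "balanced_bipartite (G_pq p q)"
  unfolding balanced_bipartite_def bipartition_def
  by (rule exI[of _ "{1..p + q}"], rule exI[of _ "{p + q + 1..2 * p + 2 * q}"])
     (auto simp: pverts_G_pq parcs_G_pq pq_arcs_iff)

text \<open>The easy direction of Hall's theorem: partners of vertices in \<open>S\<close> lie in
  \<open>N\<close>, and a vertex of \<open>N\<close> lies on only one edge of \<open>M\<close>, so
  the partner map is injective.\<close>

lemma perfect_matching_card_le:
  assumes M: "perfect_matching G M" and S: "S \<subseteq> pverts G" "S \<inter> N = {}"
    and fin: "finite N" "N \<subseteq> pverts G"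
    and nbr: "\<And>s e. s \<in> S \<Longrightarrow> e \<in> edges G \<Longrightarrow> s \<in> e \<Longrightarrow> \<exists>t\<in>N. e = {s, t}"
  shows "card S \<le> card N"
proof -
  have "\<exists>t\<in>N. {s, t} \<in> M" if "s \<in> S" for s
    using M S that nbr unfolding perfect_matching_def by (metis subsetD)
  then obtain f where f: "\<And>s. s \<in> S \<Longrightarrow> f s \<in> N \<and> {s, f s} \<in> M"
    by metis
  have "inj_on f S"
  proof (rule inj_onI)
    fix a b assume ab: "a \<in> S" "b \<in> S" "f a = f b"
    then have "{a, f a} = {b, f a}"
      using M f fin(2) unfolding perfect_matching_def
      by (metis insertCI subsetD)
    then show "a = b"
      using ab f S(2) by (auto simp: doubleton_eq_iff)
  qed
  then show ?thesis
    using f fin(1) by (intro card_inj_on_le[of f]) auto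
qed

lemma no_perfect_matching_G_pq:
  assumes "p > q"
  shows "\<not> perfect_matching (G_pq p q) M"
proof
  assume "perfect_matching (G_pq p q) M"
  then have "card {1..p} \<le> card {p + q + 1..p + 2 * q}"
    by (rule perfect_matching_card_le)
      (fastforce simp: pverts_G_pq edges_G_pq pq_arcs_iff)+
  with assms show False
    by simp
qed

section \<open>The Parter property\<close>

text \<open>The bijection lists the vertices as \<open>U\<^sub>1, V\<^sub>1, V\<^sub>2, U\<^sub>2\<close>, so that
  the matching edges join positions \<open>p + q\<close> apart.\<close>

definition pq_order :: "nat \<Rightarrow> nat \<Rightarrow> nat \<Rightarrow> nat" where
  "pq_order p q i = (if i < p then i + 1 else if i < 2 * p + q then i + q + 1 else i + 1 - (p + q))"

lemma pq_order_arcs_iff: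
  assumes "i < 2 * p + 2 * q" "j < 2 * p + 2 * q"
  shows "(pq_order p q i, pq_order p q j) \<in> pq_arcs p q \<longleftrightarrow>
    i < p \<and> p \<le> j \<and> j < p + q \<or>
    2 * p + q \<le> i \<and> p + q \<le> j \<and> j < 2 * p + q \<or>
    2 * p + q \<le> i \<and> i = j + p + q"
proof -
  consider "i < p" | "p \<le> i" "i < 2 * p + q" | "2 * p + q \<le> i" by linarith
  then show ?thesis
    using assms by cases (auto simp: pq_order_def pq_arcs_iff)
qed

lemma bij_pq_order: "bij_betw (pq_order p q) {..<2 * p + 2 * q} {1..2 * p + 2 * q}"
  by (rule bij_betw_byWitness[where f' = "\<lambda>a. if a \<le> p then a - 1 else
        if a \<le> p + q then a + p + q - 1 else a - q - 1"])
     (auto simp: pq_order_def)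

text \<open>The parameters \<open>d\<close>, \<open>e\<close>, \<open>d'\<close>, \<open>e'\<close>
  sit on the diagonal, which S(G) leaves free; off it the entries are 0, 1 or
  \<open>t\<close>.\<close>

lemma parter_matrix_pattern:
  fixes d d' e e' t :: real
  assumes "t \<noteq> 0" "i < 2 * p + 2 * q" "j < 2 * p + 2 * q" "i \<noteq> j"
  shows "four_block_mat (blk p q d 0 1 1 e 0) (blk p q 0 0 0 0 1 0) (blk p q 0 0 0 0 1 0)
       (blk p q d' 0 t t e' 0) $$ (i, j) \<noteq> 0 \<longleftrightarrow>
     (pq_order p q i, pq_order p q j) \<in> pq_arcs p q \<or> (pq_order p q j, pq_order p q i) \<in> pq_arcs p q"
proof -
  have ij: "i < (p + q) + (p + q)" "j < (p + q) + (p + q)" using assms by simp_all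
  consider "i < p + q" "j < p + q" | j' where "i < p + q" "j = j' + (p + q)" "j' < p + q"
    | i' where "i = i' + (p + q)" "i' < p + q" "j < p + q"
    | i' j' where "i = i' + (p + q)" "i' < p + q" "j = j' + (p + q)" "j' < p + q"
    using ij by (metis add.commute le_add_diff_inverse2 less_diff_conv2 not_le)
  then show ?thesis
  proof cases
    case 1
    then show ?thesis
      unfolding pq_order_arcs_iff[OF assms(2,3)] pq_order_arcs_iff[OF assms(3,2)]
      using assms by (simp add: blk_index) linarith?
  next
    case 2
    then show ?thesis
      unfolding pq_order_arcs_iff[OF assms(2,3)] pq_order_arcs_iff[OF assms(3,2)]
      using assms by (simp add: blk_index) linarith?
  next
    case 3
    then show ?thesis
      unfolding pq_order_arcs_iff[OF assms(2,3)] pq_order_arcs_iff[OF assms(3,2)]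
      using assms by (simp add: blk_index) linarith?
  next
    case 4
    then show ?thesis
      unfolding pq_order_arcs_iff[OF assms(2,3)] pq_order_arcs_iff[OF assms(3,2)]
      using assms by (simp add: blk_index) linarith?
  qed
qed

lemma parter_graph_G_pq:
  assumes "p > q" "q \<ge> 2"
  shows "parter_graph (G_pq p q)"
proof -
  obtain t d \<beta> e \<kappa> k l :: real where pos: "t > 0" "d > 0"
    and c: "\<beta> * (real q - 1) = d / q" "k - e * \<beta> = 1" "p / q + e * \<beta> + l = 0" "e * k * t = \<beta>"
      "p * \<kappa> * t / d + e * l * t + \<beta> = 0" "p * \<kappa> * q / d\<^sup>2 + e * \<kappa> / d + 1 / (t * q) = 0"
      "(real p - 1) / d + e / q + \<kappa> / d = 0" "k + l * q = \<kappa>"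
    by (rule parter_coefficients[of "real q" "real p"]) (use assms in auto)
  have nz: "t \<noteq> 0" "d \<noteq> 0" "real q \<noteq> 0"
    using pos assms by auto
  \<comment> \<open>This cancels the entries of \<open>?Y * ?W + ?X' * ?Z\<close> with row in
    \<open>V2\<close> and column in \<open>V1\<close>.\<close>
  have \<kappa>t: "\<kappa> * t = k * t + l * q * t"
    unfolding c(8)[symmetric] by (simp add: algebra_simps)
  \<comment> \<open>The inverse is the one given by the Schur complement with respect to \<open>U\<^sub>1\<close> and \<open>V\<^sub>2\<close>.\<close>
  let ?X = "blk p q (-d) 0 1 1 e 0" and ?X' = "blk p q (-d * t) 0 t t (e * t) 0"
    and ?Y = "blk p q 0 0 0 0 1 0"
    and ?W = "blk p q (-(1 / d)) (1 / d) (1 / q) (1 / q) (-\<beta>) \<beta>"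
    and ?W' = "blk p q (-(1 / (d * t))) (1 / (d * t)) (1 / (q * t)) (1 / (q * t)) (-(\<beta> / t)) (\<beta> / t)"
    and ?Z = "blk p q 0 (\<kappa> * q / d\<^sup>2) (\<kappa> / d) (\<kappa> / d) k l"
  \<comment> \<open>\<open>?X'\<close> is \<open>t\<close> times \<open>?X\<close> and
    \<open>?W'\<close> is \<open>?W\<close> divided by \<open>t\<close>, which lets one
    \<open>?Z\<close> serve as both off-diagonal blocks.\<close>
  let ?A = "four_block_mat ?X ?Y ?Y ?X'" and ?B = "four_block_mat ?W ?Z ?Z ?W'"
  let ?vs = "map (pq_order p q) [0..<2 * p + 2 * q]"
  have n: "2 * p + 2 * q = (p + q) + (p + q)"
    by simp
  \<comment> \<open>Comparing coefficients of I and J turns each matrix identity into six scalar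
    ones; those that are not plain cancellations are the relations \<open>c\<close>.\<close>
  have "?X * ?W + ?Y * ?Z = 1\<^sub>m (p + q)"
    unfolding blk_mult blk_add blk_one
    by (rule blk_cong) (use nz c in \<open>simp_all add: field_simps\<close>)
  moreover have "?X * ?Z + ?Y * ?W' = 0\<^sub>m (p + q) (p + q)"
    unfolding blk_mult blk_add blk_zero
    by (rule blk_cong) (use nz c in \<open>simp_all add: field_simps power2_eq_square\<close>)
  moreover have "?Y * ?W + ?X' * ?Z = 0\<^sub>m (p + q) (p + q)"
    unfolding blk_mult blk_add blk_zero
    by (rule blk_cong) (use nz c \<kappa>t in \<open>simp_all add: field_simps power2_eq_square\<close>)
  moreover have "?Y * ?Z + ?X' * ?W' = 1\<^sub>m (p + q)"
    unfolding blk_mult blk_add blk_one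
    by (rule blk_cong) (use nz c in \<open>simp_all add: field_simps\<close>)
  ultimately have AB: "?A * ?B = 1\<^sub>m (2 * p + 2 * q)"
    unfolding n by (intro mult_sym_block) auto
  show ?thesis
  proof (rule parter_graphI)
    show "distinct ?vs" "set ?vs = pverts (G_pq p q)"
      using bij_pq_order[of p q]
      by (simp_all add: distinct_map bij_betw_def atLeast0LessThan pverts_G_pq)
    show "?A \<in> sym_mats ?vs (G_pq p q)"
      unfolding sym_mats_def
    proof (intro CollectI conjI allI impI)
      show "?A \<in> carrier_mat (length ?vs) (length ?vs)"
        by auto
      show "transpose_mat ?A = ?A"
        by (subst transpose_four_block_mat[OF dim_blk(3) dim_blk(3) dim_blk(3) dim_blk(3)])
          (simp add: transpose_blk)
    next
      fix i j assume "i < length ?vs" "j < length ?vs" "i \<noteq> j"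
      then show "?A $$ (i, j) \<noteq> 0 \<longleftrightarrow> {?vs ! i, ?vs ! j} \<in> edges (G_pq p q)"
        using parter_matrix_pattern[OF nz(1), of i p q j] by (simp add: edge_G_pq_iff)
    qed
    show "?A * ?B = 1\<^sub>m (length ?vs)"
      using AB by simp
    show "?B \<in> carrier_mat (length ?vs) (length ?vs)"
      by auto
    \<comment> \<open>The diagonal blocks of \<open>?W\<close> and \<open>?W'\<close> are multiples
      of J - I.\<close>
    show "?B $$ (i, i) = 0" if "i < length ?vs" for i
      using that by (simp add: blk_index)
  qed
qed

theorem theorem4p1:
  shows "(\<forall>p q :: nat. p > q \<and> q \<ge> 2 \<longrightarrow>
            pair_graph (G_pq p q) \<and>
            Digraph_Component.connected (with_proj (G_pq p q)) \<and>
            balanced_bipartite (G_pq p q) \<and>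
            parter_graph (G_pq p q) \<and>
            \<not> (\<exists>M. perfect_matching (G_pq p q) M) \<and>
            cycle_rank (G_pq p q) = (int q - 1) * (2 * int p - 1)) \<and>
         (\<forall>r :: int. odd r \<and> r \<ge> 5 \<longrightarrow>
            (\<exists>G :: nat pair_pre_digraph.
               pair_graph G \<and>
               Digraph_Component.connected (with_proj G) \<and>
               balanced_bipartite G \<and>
               parter_graph G \<and>
               cycle_rank G = r \<and>
               \<not> (\<exists>M. perfect_matching G M)))"
proof (intro conjI allI impI)
  fix p q :: nat assume "p > q \<and> q \<ge> 2"
  then show "pair_graph (G_pq p q)" "Digraph_Component.connected (with_proj (G_pq p q))"
    "balanced_bipartite (G_pq p q)" "parter_graph (G_pq p q)"
    "\<not> (\<exists>M. perfect_matching (G_pq p q) M)"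
    "cycle_rank (G_pq p q) = (int q - 1) * (2 * int p - 1)"
    by (simp_all add: pair_graph_G_pq connected_G_pq balanced_bipartite_G_pq parter_graph_G_pq
        no_perfect_matching_G_pq cycle_rank_G_pq)
next
  fix r :: int assume r: "odd r \<and> r \<ge> 5"
  \<comment> \<open>For \<open>q = 2\<close> the cycle rank is \<open>2 * p - 1\<close>, and
    \<open>r \<ge> 5\<close> gives \<open>p > 2\<close>.\<close>
  define p where "p = nat ((r + 1) div 2)"
  have p: "p > 2" "2 * int p - 1 = r"
    using r by (auto simp: p_def elim: oddE)
  then show "\<exists>G :: nat pair_pre_digraph. pair_graph G \<and>
      Digraph_Component.connected (with_proj G) \<and> balanced_bipartite G \<and> parter_graph G \<and>
      cycle_rank G = r \<and> \<not> (\<exists>M. perfect_matching G M)"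
    by (intro exI[of _ "G_pq p 2"])
       (simp add: pair_graph_G_pq connected_G_pq balanced_bipartite_G_pq parter_graph_G_pq
        no_perfect_matching_G_pq cycle_rank_G_pq)
qed

end
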